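(* Let $R$ be a nonassociative ring and let $(S,x)$ be a right generalized nonassociative Ore extension (right GNOE) of $R$ that satisfies the right Euclidean division algorithm. If $R$ is left Noetherian, then $S$ is left Noetherian.
   Context: Conventions: $\mathbb{N}$ includes $0$; all rings are unital; a nonassociative ring is a ring that is not necessarily associative. A left module over a nonassociative ring $R$ is an abelian group $M$ with a biadditive map $R\times M\to M$ (no further axioms); a submodule is a subgroup closed under this multiplication; ${}_R\langle N\rangle$ denotes the smallest left $R$-submodule containing $N$. Right modules are analogous. A right $R$-module is free with basis $B$ if each element is uniquely a finite sum $\sum_{b\in B} b r_b$ with $r_b\in R$. A module is Noetherian if each of its submodules is finitely generated; $R$ is left Noetherian if it is Noetherian as a left module over itself. Right GNOE: a pair $(S,x)$ such that (RG1) $S$ is a nonassociative ring containing $R$ as a (unital) subring, and $x\in S$; (RG2) $x$ is power-associative, i.e. the subring of $S$ generated by $x$ is associative; (RG3) $S$ is a free right $R$-module with basis $\{1,x,x^2,\dots\}$; (RG4) $(x^mR)(x^nR)\subseteq R+xR+\cdots+x^{m+n}R$ for all $m,n\in\mathbb{N}$. Right degree: a nonzero $p\in S$ is uniquely $p=x^nr_n+\cdots+xr_1+r_0$ with $r_i\in R$, $r_n\ne0$; put $\deg_r p=n$, $\operatorname{lc}_r(p)=r_n$; also $\deg_r 0=-\infty$, $\operatorname{lc}_r(0)=0$ (with $-\infty$ plus anything equal to $-\infty$). Right degree-additive elements: for $p_1,\dots,p_n\in S$ and $I={}_S\langle p_1,\dots,p_n\rangle$ (the left ideal of $S$ generated by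 the $p_i$), an element $s\in I$ is right degree-additive (with respect to $p_1,\dots,p_n$) if it has a representation $s=\sum_i\sum_j s_{ijm}(\cdots(s_{ij2}(s_{ij1}p_i))\cdots)$ with $s_{ijk}\in S$, $1\le i\le n$, $1\le j,k\le m$, such that $\deg_r s=\max_i\bigl(\deg_r p_i+\max_j\sum_k\deg_r s_{ijk}\bigr)$. Right Euclidean division algorithm: $(S,x)$ satisfies it if for all $p_1,\dots,p_n\in S$ and nonzero $q\in S$ with $\deg_r q\ge\max_i\deg_r p_i$ and $\operatorname{lc}_r(q)\in{}_R\langle\operatorname{lc}_r(p_1),\dots,\operatorname{lc}_r(p_n)\rangle$, there exists a right degree-additive element $s$ of ${}_S\langle p_1,\dots,p_n\rangle$ (with respect to $p_1,\dots,p_n$) such that $\deg_r(q-s)<\deg_r q$. *)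

theory Defs
  imports
    "HOL-Algebra.Module"
    "HOL-Algebra.Coset"
    "HOL-Algebra.Subrings"
    "HOL-Algebra.Generated_Rings"
    "HOL-Library.Extended_Real"
begin

section \<open>Nonassociative rings and their modules\<close>

locale nonassoc_ring = abelian_group R for R (structure) +
  assumes mult_closed: "\<lbrakk>a \<in> carrier R; b \<in> carrier R\<rbrakk> \<Longrightarrow> a \<otimes> b \<in> carrier R"
    and one_in_carrier: "\<one> \<in> carrier R"
    and mult_one_left: "a \<in> carrier R \<Longrightarrow> \<one> \<otimes> a = a"
    and mult_one_right: "a \<in> carrier R \<Longrightarrow> a \<otimes> \<one> = a"
    and distrib_right: "\<lbrakk>a \<in> carrier R; b \<in> carrier R; c \<in> carrier R\<rbrakk>
      \<Longrightarrow> (a \<oplus> b) \<otimes> c = a \<otimes> c \<oplus> b \<otimes> c"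
    and distrib_left: "\<lbrakk>a \<in> carrier R; b \<in> carrier R; c \<in> carrier R\<rbrakk>
      \<Longrightarrow> a \<otimes> (b \<oplus> c) = a \<otimes> b \<oplus> a \<otimes> c"

text \<open>The action of a module over a nonassociative ring is only required to be biadditive.
  Hence left and right modules have the same axioms; for a right module,
  \<open>r \<odot>\<^bsub>M\<^esub> m\<close> stands for \<open>m r\<close>. The library predicate \<open>submodule N R M\<close> (an additive subgroup
  closed under the action) does not depend on associativity and is used as it is.\<close>

locale nonassoc_module = R?: nonassoc_ring R + M?: abelian_group M
  for R :: "('r, 'x) ring_scheme" (structure)
    and M :: "('r, 'm, 'y) module_scheme" (structure) +
  assumes action_closed:
      "\<lbrakk>r \<in> carrier R; m \<in> carrier M\<rbrakk> \<Longrightarrow> r \<odot>\<^bsub>M\<^esub> m \<in> carrier M"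
    and action_add_scalar:
      "\<lbrakk>r \<in> carrier R; r' \<in> carrier R; m \<in> carrier M\<rbrakk>
        \<Longrightarrow> (r \<oplus>\<^bsub>R\<^esub> r') \<odot>\<^bsub>M\<^esub> m = r \<odot>\<^bsub>M\<^esub> m \<oplus>\<^bsub>M\<^esub> r' \<odot>\<^bsub>M\<^esub> m"
    and action_add_vector:
      "\<lbrakk>r \<in> carrier R; m \<in> carrier M; m' \<in> carrier M\<rbrakk>
        \<Longrightarrow> r \<odot>\<^bsub>M\<^esub> (m \<oplus>\<^bsub>M\<^esub> m') = r \<odot>\<^bsub>M\<^esub> m \<oplus>\<^bsub>M\<^esub> r \<odot>\<^bsub>M\<^esub> m'"

definition submodule_generated ::
  "('r, 'x) ring_scheme \<Rightarrow> ('r, 'm, 'y) module_scheme \<Rightarrow> 'm set \<Rightarrow> 'm set" where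
  "submodule_generated R M A = \<Inter>{N. submodule N R M \<and> A \<subseteq> N}"

definition noetherian_module ::
  "('r, 'x) ring_scheme \<Rightarrow> ('r, 'm, 'y) module_scheme \<Rightarrow> bool" where
  "noetherian_module R M \<longleftrightarrow> nonassoc_module R M \<and>
     (\<forall>N. submodule N R M \<longrightarrow> (\<exists>A. finite A \<and> A \<subseteq> N \<and> N = submodule_generated R M A))"

definition left_regular_module :: "('a, 'x) ring_scheme \<Rightarrow> ('a, 'a) module" where
  "left_regular_module R = \<lparr>carrier = carrier R, mult = mult R, one = \<one>\<^bsub>R\<^esub>,
     zero = \<zero>\<^bsub>R\<^esub>, add = add R, smult = (\<lambda>r m. r \<otimes>\<^bsub>R\<^esub> m)\<rparr>"

definition right_regular_module :: "('a, 'x) ring_scheme \<Rightarrow> ('a, 'a) module" where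
  "right_regular_module R = \<lparr>carrier = carrier R, mult = mult R, one = \<one>\<^bsub>R\<^esub>,
     zero = \<zero>\<^bsub>R\<^esub>, add = add R, smult = (\<lambda>r m. m \<otimes>\<^bsub>R\<^esub> r)\<rparr>"

definition left_noetherian :: "('a, 'x) ring_scheme \<Rightarrow> bool" where
  "left_noetherian R \<longleftrightarrow> noetherian_module R (left_regular_module R)"

text \<open>A basis is given as a family \<open>b\<close>, so that the elements \<open>x\<^sup>0, x\<^sup>1, x\<^sup>2, \<dots>\<close>
  are linearly independent as a sequence (and in particular distinct over a nonzero ring).
  \<open>is_coordinates R M b m f\<close> says that \<open>m\<close> is the finite sum of the \<open>b\<^sub>i f(i)\<close>.\<close>

definition is_coordinates ::
  "('r, 'x) ring_scheme \<Rightarrow> ('r, 'm, 'y) module_scheme \<Rightarrow> ('i \<Rightarrow> 'm) \<Rightarrow> 'm \<Rightarrow> ('i \<Rightarrow> 'r) \<Rightarrow> bool"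
  where
  "is_coordinates R M b m f \<longleftrightarrow> f \<in> UNIV \<rightarrow> carrier R \<and> finite {i. f i \<noteq> \<zero>\<^bsub>R\<^esub>} \<and>
     m = (\<Oplus>\<^bsub>M\<^esub>i \<in> {i. f i \<noteq> \<zero>\<^bsub>R\<^esub>}. f i \<odot>\<^bsub>M\<^esub> b i)"

definition free_with_basis ::
  "('r, 'x) ring_scheme \<Rightarrow> ('r, 'm, 'y) module_scheme \<Rightarrow> ('i \<Rightarrow> 'm) \<Rightarrow> bool" where
  "free_with_basis R M b \<longleftrightarrow> nonassoc_module R M \<and> b \<in> UNIV \<rightarrow> carrier M \<and>
     (\<forall>m \<in> carrier M. \<exists>!f. is_coordinates R M b m f)"


section \<open>Right generalized nonassociative Ore extensions\<close>

definition unital_subring ::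
  "('a, 'x) ring_scheme \<Rightarrow> ('a, 'y) ring_scheme \<Rightarrow> bool" where
  "unital_subring R S \<longleftrightarrow> subring (carrier R) S \<and> \<one>\<^bsub>R\<^esub> = \<one>\<^bsub>S\<^esub> \<and>
     (\<forall>a \<in> carrier R. \<forall>b \<in> carrier R.
        a \<oplus>\<^bsub>R\<^esub> b = a \<oplus>\<^bsub>S\<^esub> b \<and> a \<otimes>\<^bsub>R\<^esub> b = a \<otimes>\<^bsub>S\<^esub> b)"

definition power_associative :: "('a, 'x) ring_scheme \<Rightarrow> 'a \<Rightarrow> bool" where
  "power_associative S x \<longleftrightarrow>
     (\<forall>a \<in> generate_ring S {x}. \<forall>b \<in> generate_ring S {x}. \<forall>c \<in> generate_ring S {x}.
        (a \<otimes>\<^bsub>S\<^esub> b) \<otimes>\<^bsub>S\<^esub> c = a \<otimes>\<^bsub>S\<^esub> (b \<otimes>\<^bsub>S\<^esub> c))"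

text \<open>The power \<open>x [^]\<^bsub>S\<^esub> n\<close> is defined by the recursion \<open>x\<^bsup>n+1\<^esup> = x\<^bsup>n\<^esup> x\<close>; the bracketing is
  immaterial for a power-associative \<open>x\<close>.\<close>

locale right_gnoe = R?: nonassoc_ring R + S?: nonassoc_ring S
  for R :: "('a, 'x) ring_scheme" (structure) and S :: "('a, 'y) ring_scheme" (structure)
    and x :: 'a +
  assumes RG1_subring: "unital_subring R S"
    and RG1_x: "x \<in> carrier S"
    and RG2: "power_associative S x"
    and RG3: "free_with_basis R (right_regular_module S) (\<lambda>n :: nat. x [^]\<^bsub>S\<^esub> n)"
    and RG4: "\<And>m n :: nat.
      (x [^]\<^bsub>S\<^esub> m <#\<^bsub>S\<^esub> carrier R) <#>\<^bsub>S\<^esub> (x [^]\<^bsub>S\<^esub> n <#\<^bsub>S\<^esub> carrier R)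
        \<subseteq> {\<Oplus>\<^bsub>S\<^esub>i \<in> {..m + n}. x [^]\<^bsub>S\<^esub> i \<otimes>\<^bsub>S\<^esub> f i | f. f \<in> {..m + n} \<rightarrow> carrier R}"

definition right_coeff ::
  "('a, 'x) ring_scheme \<Rightarrow> ('a, 'y) ring_scheme \<Rightarrow> 'a \<Rightarrow> 'a \<Rightarrow> nat \<Rightarrow> 'a" where
  "right_coeff R S x p =
     (THE f. is_coordinates R (right_regular_module S) (\<lambda>n :: nat. x [^]\<^bsub>S\<^esub> n) p f)"

definition right_deg_nat ::
  "('a, 'x) ring_scheme \<Rightarrow> ('a, 'y) ring_scheme \<Rightarrow> 'a \<Rightarrow> 'a \<Rightarrow> nat" where
  "right_deg_nat R S x p = Max {n. right_coeff R S x p n \<noteq> \<zero>\<^bsub>R\<^esub>}"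

definition right_deg ::
  "('a, 'x) ring_scheme \<Rightarrow> ('a, 'y) ring_scheme \<Rightarrow> 'a \<Rightarrow> 'a \<Rightarrow> ereal" where
  "right_deg R S x p = (if p = \<zero>\<^bsub>S\<^esub> then - \<infinity> else ereal (real (right_deg_nat R S x p)))"

definition right_lc ::
  "('a, 'x) ring_scheme \<Rightarrow> ('a, 'y) ring_scheme \<Rightarrow> 'a \<Rightarrow> 'a \<Rightarrow> 'a" where
  "right_lc R S x p =
     (if p = \<zero>\<^bsub>S\<^esub> then \<zero>\<^bsub>R\<^esub> else right_coeff R S x p (right_deg_nat R S x p))"


section \<open>The right Euclidean division algorithm\<close>

text \<open>\<open>nested_left_mult S f m p\<close> is \<open>f(m) (\<dots> (f(2) (f(1) p)) \<dots>)\<close>.\<close>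

primrec nested_left_mult ::
  "('a, 'y) ring_scheme \<Rightarrow> (nat \<Rightarrow> 'a) \<Rightarrow> nat \<Rightarrow> 'a \<Rightarrow> 'a" where
  "nested_left_mult S f 0 p = p"
| "nested_left_mult S f (Suc k) p = f (Suc k) \<otimes>\<^bsub>S\<^esub> nested_left_mult S f k p"

definition left_ideal_generated :: "('a, 'y) ring_scheme \<Rightarrow> 'a set \<Rightarrow> 'a set" where
  "left_ideal_generated S A = submodule_generated S (left_regular_module S) A"

definition right_degree_additive ::
  "('a, 'x) ring_scheme \<Rightarrow> ('a, 'y) ring_scheme \<Rightarrow> 'a \<Rightarrow> nat \<Rightarrow> (nat \<Rightarrow> 'a) \<Rightarrow> 'a \<Rightarrow> bool" where
  "right_degree_additive R S x n p s \<longleftrightarrow>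
     s \<in> left_ideal_generated S (p ` {1..n}) \<and>
     (\<exists>m c. m \<ge> 1 \<and>
        (\<forall>i \<in> {1..n}. \<forall>j \<in> {1..m}. \<forall>k \<in> {1..m}. c i j k \<in> carrier S) \<and>
        s = (\<Oplus>\<^bsub>S\<^esub>i \<in> {1..n}. \<Oplus>\<^bsub>S\<^esub>j \<in> {1..m}. nested_left_mult S (c i j) m (p i)) \<and>
        right_deg R S x s =
          (MAX i \<in> {1..n}. right_deg R S x (p i) +
             (MAX j \<in> {1..m}. \<Sum>k = 1..m. right_deg R S x (c i j k))))"

definition right_euclidean_division ::
  "('a, 'x) ring_scheme \<Rightarrow> ('a, 'y) ring_scheme \<Rightarrow> 'a \<Rightarrow> bool" where
  "right_euclidean_division R S x \<longleftrightarrow>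
     (\<forall>n p q. n \<ge> 1 \<and> p \<in> {1..n} \<rightarrow> carrier S \<and> q \<in> carrier S \<and> q \<noteq> \<zero>\<^bsub>S\<^esub> \<and>
        right_deg R S x q \<ge> (MAX i \<in> {1..n}. right_deg R S x (p i)) \<and>
        right_lc R S x q \<in> left_ideal_generated R ((\<lambda>i. right_lc R S x (p i)) ` {1..n}) \<longrightarrow>
        (\<exists>s. right_degree_additive R S x n p s \<and>
             right_deg R S x (q \<ominus>\<^bsub>S\<^esub> s) < right_deg R S x q))"

end

theory Submission
  imports Defs
begin

text \<open>The argument is Hilbert's basis theorem in its ``minimal degree'' form. If a left ideal \<open>I\<close>
  of \<open>S\<close> were not finitely generated, one could choose \<open>p\<^sub>0, p\<^sub>1, \<dots>\<close> in \<open>I\<close> such that \<open>p\<^sub>k\<close> has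
  least degree among the elements of \<open>I\<close> outside the left ideal \<open>L\<^sub>k\<close> generated by the
  earlier ones (\<open>exists_minimal_degree_sequence\<close>). The \<open>L\<^sub>k\<close> increase, so \<open>p\<^sub>n\<close> competes in the
  choice of every earlier \<open>p\<^sub>i\<close>, and the degrees are weakly increasing. Since \<open>R\<close> is left
  Noetherian, some leading coefficient \<open>lc(p\<^sub>n)\<close> lies in the left ideal of \<open>R\<close>
  generated by the earlier leading coefficients
  (\<open>noetherian_sequence_dependent\<close>). Euclidean division then yields \<open>s \<in> L\<^sub>n\<close> with
  \<open>deg (p\<^sub>n - s) < deg p\<^sub>n\<close>. But \<open>p\<^sub>n - s\<close> is again in \<open>I\<close> and outside \<open>L\<^sub>n\<close>, which contradicts
  the minimality of \<open>deg p\<^sub>n\<close>.\<close>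

context nonassoc_module
begin

lemma submodule_carrier: "submodule (carrier M) R M"
  by (simp add: submodule_def submodule_axioms_def action_closed M.add.subgroup_self)

lemma submodule_submodule_generated:
  assumes "A \<subseteq> carrier M"
  shows "submodule (submodule_generated R M A) R M"
proof -
  let ?F = "{N. submodule N R M \<and> A \<subseteq> N}"
  have carrier_in: "carrier M \<in> ?F"
    using submodule_carrier assms by simp
  have "subgroup (\<Inter>?F) (add_monoid M)"
    using carrier_in by (intro M.add.subgroups_Inter) (auto simp: submodule_def)
  then show ?thesis
    by (auto simp: submodule_generated_def submodule_def submodule_axioms_def)
qed

lemma submodule_generated_superset: "A \<subseteq> submodule_generated R M A"
  by (auto simp: submodule_generated_def)

lemma submodule_generated_least:
  "submodule N R M \<Longrightarrow> A \<subseteq> N \<Longrightarrow> submodule_generated R M A \<subseteq> N"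
  by (auto simp: submodule_generated_def)

lemma submodule_generated_mono:
  "A \<subseteq> B \<Longrightarrow> submodule_generated R M A \<subseteq> submodule_generated R M B"
  by (auto simp: submodule_generated_def)

lemma submodule_Union_chain:
  fixes N :: "nat \<Rightarrow> _"
  assumes sub: "\<And>k. submodule (N k) R M" and "mono N"
  shows "submodule (\<Union>k. N k) R M"
proof -
  have group: "subgroup (N k) (add_monoid M)" for k
    using sub by (simp add: submodule_def)
  have add_closed: "a \<oplus>\<^bsub>M\<^esub> b \<in> (\<Union>k. N k)" if "a \<in> N i" "b \<in> N j" for a b i j
  proof -
    have "a \<in> N (max i j)" "b \<in> N (max i j)"
      using that monoD[OF \<open>mono N\<close>, of i "max i j"] monoD[OF \<open>mono N\<close>, of j "max i j"] by auto
    then show ?thesis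
      using subgroup.m_closed[OF group] by fastforce
  qed
  have "subgroup (\<Union>k. N k) (add_monoid M)"
  proof (rule M.add.subgroupI)
    show "(\<Union>k. N k) \<subseteq> carrier M"
      using subgroup.subset[OF group] by auto
    show "(\<Union>k. N k) \<noteq> {}"
      using subgroup.one_closed[OF group] by auto
  next
    fix a assume "a \<in> (\<Union>k. N k)"
    then show "\<ominus>\<^bsub>M\<^esub> a \<in> (\<Union>k. N k)"
      using subgroup.m_inv_closed[OF group] by (auto simp: a_inv_def)
  qed (use add_closed in auto)
  then show ?thesis
    using sub by (auto simp: submodule_def submodule_axioms_def)
qed

text \<open>This is the ascending chain condition for the submodules generated by the initial segments of
  the sequence: a finite generating set of their union already lies in one of them.\<close>

lemma noetherian_sequence_dependent:
  assumes "noetherian_module R M" and a: "\<And>k :: nat. a k \<in> carrier M"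
  obtains n where "n \<ge> 1" and "a n \<in> submodule_generated R M (a ` {..<n})"
proof -
  define N where "N k = submodule_generated R M (a ` {..<k})" for k
  have sub: "submodule (N k) R M" for k
    unfolding N_def using a by (intro submodule_submodule_generated) auto
  have "mono N"
    unfolding N_def by (intro monoI submodule_generated_mono) auto
  obtain A where A: "finite A" "A \<subseteq> (\<Union>k. N k)" "(\<Union>k. N k) = submodule_generated R M A"
    using assms(1) submodule_Union_chain[OF sub \<open>mono N\<close>] unfolding noetherian_module_def by meson
  obtain K where K: "\<And>b. b \<in> A \<Longrightarrow> b \<in> N (K b)"
    using A(2) by (metis UN_E subsetD)
  \<comment> \<open>The 1 makes the bound positive even for an empty generating set.\<close>
  define n where "n = Max (insert 1 (K ` A))"
  have "A \<subseteq> N n"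
  proof
    fix b assume "b \<in> A"
    then have "K b \<le> n"
      unfolding n_def using A(1) by (intro Max_ge) auto
    then show "b \<in> N n"
      using K[OF \<open>b \<in> A\<close>] monoD[OF \<open>mono N\<close>] by blast
  qed
  then have "(\<Union>k. N k) \<subseteq> N n"
    unfolding A(3) by (rule submodule_generated_least[OF sub])
  moreover have "a n \<in> N (Suc n)"
    using submodule_generated_superset[of "a ` {..<Suc n}"] by (auto simp: N_def)
  ultimately have "a n \<in> submodule_generated R M (a ` {..<n})"
    unfolding N_def by blast
  moreover have "n \<ge> 1"
    unfolding n_def using A(1) by (intro Max_ge) auto
  ultimately show thesis
    using that by blast
qed

end

text \<open>Well-ordered values make least choices possible at each stage; the set
  left to choose from is nonempty because finitely many elements never generate \<open>I\<close>.\<close>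

lemma exists_minimal_degree_sequence:
  fixes deg :: "'m \<Rightarrow> nat"
  assumes sub: "submodule I R M"
    and not_fg: "\<not> (\<exists>A. finite A \<and> A \<subseteq> I \<and> I = submodule_generated R M A)"
  obtains p :: "nat \<Rightarrow> 'm"
  where "\<And>k. p k \<in> I - submodule_generated R M (p ` {..<k})"
    and "\<And>k r. r \<in> I - submodule_generated R M (p ` {..<k}) \<Longrightarrow> deg (p k) \<le> deg r"
proof -
  define choice where "choice f k r \<longleftrightarrow> r \<in> I - submodule_generated R M (f ` {..<k}) \<and>
      (\<forall>r' \<in> I - submodule_generated R M (f ` {..<k}). deg r \<le> deg r')"
    for f :: "nat \<Rightarrow> 'm" and k r
  have "\<exists>p. \<forall>k. choice p k (p k)"
  proof (rule dependent_wellorder_choice)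
    fix r k and f g :: "nat \<Rightarrow> 'm"
    assume "\<And>y. y < k \<Longrightarrow> f y = g y"
    then have "f ` {..<k} = g ` {..<k}"
      by (intro image_cong) auto
    then show "choice f k r = choice g k r"
      by (simp add: choice_def)
  next
    fix k and f :: "nat \<Rightarrow> 'm"
    assume "\<And>y. y < k \<Longrightarrow> choice f y (f y)"
    then have in_I: "f ` {..<k} \<subseteq> I"
      by (auto simp: choice_def)
    then have "submodule_generated R M (f ` {..<k}) \<subseteq> I"
      using sub by (auto simp: submodule_generated_def)
    moreover have "I \<noteq> submodule_generated R M (f ` {..<k})"
      using not_fg in_I by blast
    ultimately obtain r where "r \<in> I - submodule_generated R M (f ` {..<k})"
      by blast
    then show "\<exists>r. choice f k r"
      using ex_has_least_nat[of "\<lambda>r. r \<in> I - submodule_generated R M (f ` {..<k})" r deg]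
      by (auto simp: choice_def)
  qed
  then show thesis
    using that by (auto simp: choice_def)
qed

context nonassoc_ring
begin

lemma nonassoc_module_left_regular: "nonassoc_module R (left_regular_module R)"
proof -
  have "abelian_group (left_regular_module R)"
  proof (rule abelian_groupI)
    fix a assume "a \<in> carrier (left_regular_module R)"
    then show "\<exists>b \<in> carrier (left_regular_module R).
        b \<oplus>\<^bsub>left_regular_module R\<^esub> a = \<zero>\<^bsub>left_regular_module R\<^esub>"
      by (intro bexI[of _ "\<ominus> a"]) (simp_all add: left_regular_module_def l_neg)
  qed (simp_all add: left_regular_module_def a_assoc a_comm a_lcomm)
  then show ?thesis
    by (simp add: nonassoc_module_def nonassoc_module_axioms_def nonassoc_ring_axioms
        left_regular_module_def mult_closed distrib_left distrib_right)
qed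

lemma submodule_left_regular_imp_subgroup:
  assumes "submodule I R (left_regular_module R)"
  shows "subgroup I (add_monoid R)"
proof -
  have "subgroup I (add_monoid (left_regular_module R))"
    using assms by (simp add: submodule_def)
  then show ?thesis
    by (simp add: subgroup_def m_inv_def left_regular_module_def)
qed

end

context right_gnoe
begin

lemma right_lc_in_carrier:
  assumes "p \<in> carrier S"
  shows "right_lc R S x p \<in> carrier R"
proof -
  have "\<exists>!f. is_coordinates R (right_regular_module S) (\<lambda>n :: nat. x [^]\<^bsub>S\<^esub> n) p f"
    using RG3 assms by (simp add: free_with_basis_def right_regular_module_def)
  from theI'[OF this] have "right_coeff R S x p n \<in> carrier R" for n
    unfolding right_coeff_def[symmetric] by (auto simp: is_coordinates_def)
  then show ?thesis
    by (simp add: right_lc_def)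
qed

end

theorem theorem2:
  fixes R :: "('a, 'x) ring_scheme" and S :: "('a, 'y) ring_scheme" and x :: 'a
  assumes "nonassoc_ring R"
    and "right_gnoe R S x"
    and "right_euclidean_division R S x"
    and "left_noetherian R"
  shows "left_noetherian S"
proof -
  interpret right_gnoe R S x by fact
  let ?M = "left_regular_module S"
  let ?deg = "right_deg R S x" and ?lc = "right_lc R S x"
  interpret RM: nonassoc_module R "left_regular_module R"
    by (rule R.nonassoc_module_left_regular)
  interpret SM: nonassoc_module S ?M
    by (rule S.nonassoc_module_left_regular)
  have carrier_M: "carrier ?M = carrier S"
    by (simp add: left_regular_module_def)
  have "\<exists>A. finite A \<and> A \<subseteq> I \<and> I = submodule_generated S ?M A" if I: "submodule I S ?M" for I
  proof (rule ccontr)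
    assume not_fg: "\<not> ?thesis"
    obtain p :: "nat \<Rightarrow> 'a"
      where p_mem: "\<And>k. p k \<in> I - submodule_generated S ?M (p ` {..<k})"
        and p_min: "\<And>k r. r \<in> I - submodule_generated S ?M (p ` {..<k})
          \<Longrightarrow> right_deg_nat R S x (p k) \<le> right_deg_nat R S x r"
      by (rule exists_minimal_degree_sequence[OF I not_fg, of "right_deg_nat R S x"]) (rule that)
    define L where "L k = submodule_generated S ?M (p ` {..<k})" for k
    have I_group: "subgroup I (add_monoid S)"
      by (rule S.submodule_left_regular_imp_subgroup[OF I])
    have p_carrier: "p k \<in> carrier S" for k
      using p_mem[of k] subgroup.subset[OF I_group] by auto
    have L: "submodule (L k) S ?M" for k
      unfolding L_def using p_carrier
      by (intro SM.submodule_submodule_generated) (auto simp: carrier_M)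
    have L_group: "subgroup (L k) (add_monoid S)" for k
      by (rule S.submodule_left_regular_imp_subgroup[OF L])
    have nonzero: "r \<noteq> \<zero>\<^bsub>S\<^esub>" if "r \<in> I - L k" for r k
      using that subgroup.one_closed[OF L_group[of k]] by auto
    have deg_min: "?deg (p k) \<le> ?deg r" if "r \<in> I - L k" for r k
      using p_min[of r k] nonzero[OF that] that by (auto simp: right_deg_def L_def)
    obtain n where n: "n \<ge> 1"
      and lc_mem: "?lc (p n) \<in> left_ideal_generated R ((\<lambda>k. ?lc (p k)) ` {..<n})"
      using RM.noetherian_sequence_dependent[of "\<lambda>k. ?lc (p k)"] assms(4) p_carrier
        right_lc_in_carrier
      by (auto simp: left_noetherian_def left_ideal_generated_def left_regular_module_def)
    \<comment> \<open>The division algorithm numbers its divisors from 1, the sequence starts at 0.\<close>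
    let ?p = "\<lambda>i. p (i - 1)"
    have shift: "(\<lambda>i. h (i - 1)) ` {1..n} = h ` {..<n}" for h :: "nat \<Rightarrow> 'a"
    proof -
      have "(\<lambda>i. i - 1) ` {1..n} = {..<n}"
        by (force simp: image_iff intro: bexI[of _ "Suc k" for k])
      then show ?thesis
        by (metis image_image)
    qed
    have deg_mono: "?deg (?p i) \<le> ?deg (p n)" if "i \<in> {1..n}" for i
    proof (rule deg_min)
      have "L (i - 1) \<subseteq> L n"
        unfolding L_def using that by (intro SM.submodule_generated_mono image_mono) auto
      then show "p n \<in> I - L (i - 1)"
        using p_mem[of n] by (auto simp: L_def)
    qed
    have p_n: "p n \<in> I - L n"
      using p_mem[of n] by (simp add: L_def)
    have "(MAX i \<in> {1..n}. ?deg (?p i)) \<le> ?deg (p n)"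
      using n deg_mono by (intro Max.boundedI) auto
    then have "\<exists>s. right_degree_additive R S x n ?p s \<and> ?deg (p n \<ominus>\<^bsub>S\<^esub> s) < ?deg (p n)"
      using assms(3)[unfolded right_euclidean_division_def, rule_format, of n ?p "p n"]
        n p_carrier nonzero[OF p_n] lc_mem shift[of "\<lambda>k. ?lc (p k)"]
      by auto
    then obtain s where s: "s \<in> L n" and less: "?deg (p n \<ominus>\<^bsub>S\<^esub> s) < ?deg (p n)"
      using shift[of p] by (auto simp: right_degree_additive_def left_ideal_generated_def L_def)
    have "L n \<subseteq> I"
      unfolding L_def using p_mem by (intro SM.submodule_generated_least[OF I]) auto
    then have "p n \<ominus>\<^bsub>S\<^esub> s \<in> I"
      using s p_n subgroup.m_closed[OF I_group] subgroup.m_inv_closed[OF I_group]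
      by (auto simp: a_minus_def a_inv_def)
    moreover have "p n \<ominus>\<^bsub>S\<^esub> s \<notin> L n"
    proof
      assume "p n \<ominus>\<^bsub>S\<^esub> s \<in> L n"
      then have "(p n \<ominus>\<^bsub>S\<^esub> s) \<oplus>\<^bsub>S\<^esub> s \<in> L n"
        using s subgroup.m_closed[OF L_group] by fastforce
      moreover have "(p n \<ominus>\<^bsub>S\<^esub> s) \<oplus>\<^bsub>S\<^esub> s = p n"
        using s subgroup.subset[OF L_group[of n]] p_carrier[of n]
        by (auto simp: a_minus_def S.a_assoc S.l_neg subset_iff)
      ultimately show False
        using p_n by auto
    qed
    ultimately show False
      using deg_min[of "p n \<ominus>\<^bsub>S\<^esub> s" n] less by auto
  qed
  then show ?thesis
    by (simp add: left_noetherian_def noetherian_module_def SM.nonassoc_module_axioms)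
qed

end
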